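(* Let $G$ be an AG-group, and define a quaternary relation $P\subseteq G^4$ by $P(a,b,c,d)\Leftrightarrow Par(a,b,d,c)$. Then $(G,P)$ is a parallelogram space.
   Context: An AG-group is a set $G$ with a binary operation (written as juxtaposition, in general neither associative nor commutative) satisfying the left invertive law $(xy)z=(zy)x$ for all $x,y,z\in G$, having a left identity $e$ (so $ex=x$ for all $x\in G$), and such that every $a\in G$ has an inverse $a^{-1}\in G$ with $a^{-1}a=aa^{-1}=e$. For $a,b,c,d\in G$, we say that $a,b,c,d$ form a parallelogram, written $Par(a,b,c,d)$, if there are $p,q\in G$ such that $pa=qb$ and $pd=qc$. A parallelogram space is a nonempty set $Q$ with a quaternary relation $P\subseteq Q^4$ such that: (P1) if $P(a,b,c,d)$ holds then $P(a,c,b,d)$ holds, for all $a,b,c,d\in Q$; (P2) if $P(a,b,c,d)$ holds then $P(c,d,a,b)$ holds, for all $a,b,c,d\in Q$; (P3) if $P(a,b,f,g)$ and $P(f,g,c,d)$ hold then $P(a,b,c,d)$ holds, for all $a,b,c,d,f,g\in Q$; (P4) for any three points $a,b,c\in Q$ there is one and only one point $d\in Q$ such that $P(a,b,c,d)$ holds. *)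

theory Defs
  imports Main
begin

locale ag_group =
  fixes G :: "'a set" and mul :: "'a \<Rightarrow> 'a \<Rightarrow> 'a" (infixl "\<cdot>" 70) and e :: 'a
  assumes closed: "\<lbrakk>x \<in> G; y \<in> G\<rbrakk> \<Longrightarrow> x \<cdot> y \<in> G"
    and left_invertive: "\<lbrakk>x \<in> G; y \<in> G; z \<in> G\<rbrakk> \<Longrightarrow> (x \<cdot> y) \<cdot> z = (z \<cdot> y) \<cdot> x"
    and left_id_closed: "e \<in> G"
    and left_id: "x \<in> G \<Longrightarrow> e \<cdot> x = x"
    and inverse: "a \<in> G \<Longrightarrow> \<exists>b\<in>G. b \<cdot> a = e \<and> a \<cdot> b = e"

definition Par :: "'a set \<Rightarrow> ('a \<Rightarrow> 'a \<Rightarrow> 'a) \<Rightarrow> 'a \<Rightarrow> 'a \<Rightarrow> 'a \<Rightarrow> 'a \<Rightarrow> bool" where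
  "Par G mul a b c d \<longleftrightarrow>
     a \<in> G \<and> b \<in> G \<and> c \<in> G \<and> d \<in> G \<and>
     (\<exists>p\<in>G. \<exists>q\<in>G. mul p a = mul q b \<and> mul p d = mul q c)"

locale parallelogram_space =
  fixes Q :: "'a set" and P :: "('a \<times> 'a \<times> 'a \<times> 'a) set"
  assumes nonempty: "Q \<noteq> {}"
    and rel: "P \<subseteq> Q \<times> Q \<times> Q \<times> Q"
    and P1: "\<lbrakk>a \<in> Q; b \<in> Q; c \<in> Q; d \<in> Q; (a, b, c, d) \<in> P\<rbrakk> \<Longrightarrow> (a, c, b, d) \<in> P"
    and P2: "\<lbrakk>a \<in> Q; b \<in> Q; c \<in> Q; d \<in> Q; (a, b, c, d) \<in> P\<rbrakk> \<Longrightarrow> (c, d, a, b) \<in> P"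
    and P3: "\<lbrakk>a \<in> Q; b \<in> Q; c \<in> Q; d \<in> Q; f \<in> Q; g \<in> Q;
              (a, b, f, g) \<in> P; (f, g, c, d) \<in> P\<rbrakk> \<Longrightarrow> (a, b, c, d) \<in> P"
    and P4: "\<lbrakk>a \<in> Q; b \<in> Q; c \<in> Q\<rbrakk> \<Longrightarrow> \<exists>!d. d \<in> Q \<and> (a, b, c, d) \<in> P"

end

(* The operation a + b = (a e) b makes G an abelian group, and a b = (a e) + b.
   A parallelogram Par(a, b, d, c) then says u + a = v + b and u + c = v + d for some u, v
   in G, that is, a + d = b + c, and the axioms become identities in abelian groups. *)
theory Submission
  imports Defs
begin

context ag_group
begin

definition add :: "'a \<Rightarrow> 'a \<Rightarrow> 'a" (infixl "\<oplus>" 65) where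
  "a \<oplus> b = (a \<cdot> e) \<cdot> b"

lemma add_closed [simp]: "\<lbrakk>a \<in> G; b \<in> G\<rbrakk> \<Longrightarrow> a \<oplus> b \<in> G"
  by (simp add: add_def closed left_id_closed)

lemma add_commute: "\<lbrakk>a \<in> G; b \<in> G\<rbrakk> \<Longrightarrow> a \<oplus> b = b \<oplus> a"
  unfolding add_def by (rule left_invertive) (auto simp: left_id_closed)

text \<open>Left invertivity exchanges the outer factors, giving
  \<open>(e \<cdot> e) \<cdot> a\<close>. Right multiplication by \<open>e\<close> is thus an
  involution, which lets \<open>mul\<close> be recovered from \<open>add\<close>.\<close>

lemma mul_e_mul_e: "a \<in> G \<Longrightarrow> (a \<cdot> e) \<cdot> e = a"
  using left_invertive[of a e e] by (simp add: left_id left_id_closed)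

lemma mul_eq_add: "\<lbrakk>a \<in> G; b \<in> G\<rbrakk> \<Longrightarrow> a \<cdot> b = (a \<cdot> e) \<oplus> b"
  by (simp add: add_def mul_e_mul_e)

text \<open>A double sum is the product \<open>(b \<cdot> (a \<cdot> e)) \<cdot> c\<close>, in which
  left invertivity swaps \<open>b\<close> and \<open>c\<close>. Commutativity turns this swap into a
  rotation, and the rotation into associativity.\<close>

lemma add_rotate:
  assumes "a \<in> G" "b \<in> G" "c \<in> G"
  shows "(a \<oplus> b) \<oplus> c = (c \<oplus> a) \<oplus> b"
proof -
  have mul_e: "(x \<oplus> y) \<cdot> e = y \<cdot> (x \<cdot> e)" if "x \<in> G" "y \<in> G" for x y
    unfolding add_def using left_invertive[of "x \<cdot> e" y e] that
    by (simp add: left_id left_id_closed closed)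
  have "(a \<oplus> b) \<oplus> c = (b \<cdot> (a \<cdot> e)) \<cdot> c"
    using mul_e[of a b] assms by (simp add: add_def)
  also have "\<dots> = (c \<cdot> (a \<cdot> e)) \<cdot> b"
    using assms by (intro left_invertive) (auto simp: closed left_id_closed)
  also have "\<dots> = (a \<oplus> c) \<oplus> b"
    using mul_e[of a c] assms by (simp add: add_def)
  finally show ?thesis
    using assms by (simp add: add_commute)
qed

lemma add_assoc:
  assumes "a \<in> G" "b \<in> G" "c \<in> G"
  shows "(a \<oplus> b) \<oplus> c = a \<oplus> (b \<oplus> c)"
  using assms add_rotate[of b c a] add_commute[of "b \<oplus> c" a] by simp

lemma add_left_commute:
  assumes "a \<in> G" "b \<in> G" "c \<in> G"
  shows "a \<oplus> (b \<oplus> c) = b \<oplus> (a \<oplus> c)"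
  using assms by (metis add_assoc add_commute)

lemmas add_ac = add_assoc add_commute add_left_commute

lemma e_add: "a \<in> G \<Longrightarrow> e \<oplus> a = a"
  by (simp add: add_def left_id left_id_closed)

lemma add_inverse:
  assumes "a \<in> G"
  obtains b where "b \<in> G" "b \<oplus> a = e"
proof -
  obtain b where b: "b \<in> G" "b \<cdot> a = e"
    using inverse[OF assms] by blast
  \<comment> \<open>The additive inverse is not \<open>b\<close> itself but
    \<open>b \<cdot> e\<close>, by the translation of products into sums.\<close>
  with assms have "(b \<cdot> e) \<oplus> a = e"
    using mul_eq_add by simp
  with b show ?thesis
    by (intro that[of "b \<cdot> e"]) (auto simp: closed left_id_closed)
qed

lemma add_left_cancel:
  assumes "a \<in> G" "b \<in> G" "c \<in> G"
  shows "a \<oplus> b = a \<oplus> c \<longleftrightarrow> b = c"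
proof
  obtain n where n: "n \<in> G" "n \<oplus> a = e"
    using add_inverse assms by blast
  assume "a \<oplus> b = a \<oplus> c"
  then have "(n \<oplus> a) \<oplus> b = (n \<oplus> a) \<oplus> c"
    using assms n(1) by (simp add: add_assoc)
  with assms n show "b = c"
    by (simp add: e_add)
qed simp

text \<open>Add the two equations and cancel \<open>u \<oplus> v\<close>. This serves twice: to
  eliminate the multipliers \<open>p\<close>, \<open>q\<close> of a parallelogram, and to eliminate
  the intermediate pair in P3.\<close>

lemma add_cancel_cross:
  assumes "a \<in> G" "b \<in> G" "c \<in> G" "d \<in> G" "u \<in> G" "v \<in> G"
    and "a \<oplus> u = b \<oplus> v" "v \<oplus> d = u \<oplus> c"
  shows "a \<oplus> d = b \<oplus> c"
proof -
  have "(u \<oplus> v) \<oplus> (a \<oplus> d) = (a \<oplus> u) \<oplus> (v \<oplus> d)"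
    using assms(1-6) by (simp add: add_ac)
  also have "\<dots> = (u \<oplus> v) \<oplus> (b \<oplus> c)"
    unfolding assms(7,8) using assms(1-6) by (simp add: add_ac)
  finally show ?thesis
    using assms(1-6) by (simp add: add_left_cancel)
qed

lemma Par_iff:
  assumes "a \<in> G" "b \<in> G" "c \<in> G" "d \<in> G"
  shows "Par G (\<cdot>) a b d c \<longleftrightarrow> a \<oplus> d = b \<oplus> c"
proof
  assume "Par G (\<cdot>) a b d c"
  then obtain p q where pq: "p \<in> G" "q \<in> G" "p \<cdot> a = q \<cdot> b" "p \<cdot> c = q \<cdot> d"
    unfolding Par_def by blast
  have [simp]: "p \<cdot> e \<in> G" "q \<cdot> e \<in> G"
    using pq by (auto simp: closed left_id_closed)
  have "(p \<cdot> e) \<oplus> a = (q \<cdot> e) \<oplus> b" "(p \<cdot> e) \<oplus> c = (q \<cdot> e) \<oplus> d"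
    using pq assms by (metis mul_eq_add)+
  then show "a \<oplus> d = b \<oplus> c"
    using assms add_cancel_cross[of a b c d "p \<cdot> e" "q \<cdot> e"]
    by (simp add: add_commute)
next
  assume "a \<oplus> d = b \<oplus> c"
  \<comment> \<open>The witnesses are \<open>p = b \<cdot> e\<close> and
    \<open>q = a \<cdot> e\<close>: the first equation becomes commutativity of \<open>a\<close> and
    \<open>b\<close>, the second the assumption.\<close>
  then have "(b \<cdot> e) \<cdot> a = (a \<cdot> e) \<cdot> b \<and> (b \<cdot> e) \<cdot> c = (a \<cdot> e) \<cdot> d"
    using assms add_commute[of a b] by (simp add: add_def)
  moreover have "a \<cdot> e \<in> G" "b \<cdot> e \<in> G"
    using assms by (auto simp: closed left_id_closed)
  ultimately show "Par G (\<cdot>) a b d c"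
    unfolding Par_def using assms by blast
qed

text \<open>With \<open>n\<close> the additive inverse of \<open>a\<close>, the solution is
  \<open>n \<oplus> s\<close>; cancellation makes it unique. This yields P4 for
  \<open>s = b \<oplus> c\<close>.\<close>

lemma add_solve:
  assumes "a \<in> G" "s \<in> G"
  shows "\<exists>!d. d \<in> G \<and> a \<oplus> d = s"
proof -
  obtain n where n: "n \<in> G" "n \<oplus> a = e"
    using add_inverse assms by blast
  have "a \<oplus> (n \<oplus> s) = (n \<oplus> a) \<oplus> s"
    using assms n(1) by (simp add: add_ac)
  then have "n \<oplus> s \<in> G \<and> a \<oplus> (n \<oplus> s) = s"
    using assms n by (simp add: e_add)
  with assms show ?thesis
    by (metis add_left_cancel)
qed

end

theorem theorem2:
  fixes G :: "'a set" and mul :: "'a \<Rightarrow> 'a \<Rightarrow> 'a" and e :: 'a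
  assumes "ag_group G mul e"
  shows "parallelogram_space G
    {(a, b, c, d). a \<in> G \<and> b \<in> G \<and> c \<in> G \<and> d \<in> G \<and> Par G mul a b d c}"
proof -
  interpret ag_group G mul e by fact
  have P_iff: "{(a, b, c, d). a \<in> G \<and> b \<in> G \<and> c \<in> G \<and> d \<in> G \<and> Par G mul a b d c}
      = {(a, b, c, d). a \<in> G \<and> b \<in> G \<and> c \<in> G \<and> d \<in> G \<and> add a d = add b c}"
    using Par_iff by auto
  show ?thesis
    unfolding P_iff
  proof (unfold_locales, goal_cases)
    case 1
    then show ?case using left_id_closed by blast
  next
    case 2
    then show ?case by auto
  next
    case (3 a b c d)
    \<comment> \<open>P1 exchanges the summands in \<open>b \<oplus> c\<close>; P2 below also
      exchanges the two sides of the equation.\<close>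
    then show ?case by (simp add: add_commute)
  next
    case (4 a b c d)
    then show ?case by (simp add: add_commute)
  next
    case (5 a b c d f g)
    \<comment> \<open>Here \<open>g\<close> and \<open>f\<close> play the roles of \<open>u\<close>
      and \<open>v\<close>.\<close>
    then show ?case using add_cancel_cross[of a b c d g f] by simp
  next
    case (6 a b c)
    then show ?case using add_solve[of a "add b c"] by auto
  qed
qed

end
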